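(* There exist two continuous functions $d_\pm: [0, 1] \to [0,\infty)$ that satisfy the following properties. (i) For any $0 < a < 1$ we have the explicit expression $d_+(a) = \frac{g'(a;a)}{4}$, together with the identities $d_-(a) = d_-(1 - a)$, $d_+(a) = d_+(1 - a)$ and the inequality $d_-(a) < d_+(a)$. In addition, we have $d_-(0) = d_+(0) = d_-(1) = d_+(1) = 0$ together with $d_-(\frac{1}{2}) = \frac{1}{24}$. (ii) We have $d_- \in C^\infty\big([0, \frac{1}{2}) \big) \cap C^\infty\big( (\frac{1}{2}, 1] \big)$. In addition, $d_-$ is strictly increasing on $[0, \frac{1}{2}]$ and strictly decreasing on $[\frac{1}{2}, 1]$. (iii) Pick any $a \in (0, 1)$. The equation $G(u,v;a,d) = 0$ has nine distinct real roots $(u,v)$ for $0 \le d < d_-(a)$, five distinct real roots for $d_-(a) < d < d_+(a)$ and three distinct real roots for $d \ge d_+(a)$. (iv) Pick any $a \in (0, 1)$. The equation $G(u,v;a,d) = 0$ has seven distinct real roots for $d = d_-(a)$ if $a \neq \frac{1}{2}$ and five if $a = \frac{1}{2}$. (v) We have the expansion $d_-(a) = \frac{1}{8} a^2 + \frac{1}{32} a^4 + O(a^5)$ for $a \downarrow 0$. In addition, writing $a_{-}: [0, \frac{1}{24}] \to [0, \frac{1}{2}]$ for the inverse function of $d_-$ on $[0, \frac{1}{2}]$, we have the expansion $$a_-(d) = \frac{1}{2} - \sqrt{-1152\big(d - \tfrac{1}{24}\big)^3} + O \big( ( d - \tfrac{1}{24})^2 \big)$$ as $d \uparrow \frac{1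}{24}$.
   Context: Let $g(u;a) = u(1-u)(u-a)$, with $g'$ the derivative with respect to $u$, and $G(u,v;a,d) = \big( 2d(v-u) + g(u;a),\ 2d(u-v) + g(v;a) \big)^T$. *)

theory Defs
  imports "HOL-Analysis.Analysis" "HOL-Library.Landau_Symbols"
begin

definition g :: "real \<Rightarrow> real \<Rightarrow> real" where
  "g u a = u * (1 - u) * (u - a)"

definition G :: "real \<Rightarrow> real \<Rightarrow> real \<Rightarrow> real \<Rightarrow> real \<times> real" where
  "G u v a d = (2 * d * (v - u) + g u a, 2 * d * (u - v) + g v a)"

definition G_roots :: "real \<Rightarrow> real \<Rightarrow> (real \<times> real) set" where
  "G_roots a d = {(u, v). G u v a d = 0}"

(* F n is the n-th derivative of f on S.  Derivatives are taken within S, so they are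
   one-sided at an endpoint of an interval S that belongs to S, and depend only on the
   values of f on S.  Meant for nondegenerate intervals S, where F n is unique on S;
   continuity of every F n on S follows from its differentiability. *)
definition C_infinity_on :: "real set \<Rightarrow> (real \<Rightarrow> real) \<Rightarrow> bool" where
  "C_infinity_on S f \<longleftrightarrow>
     (\<exists>F :: nat \<Rightarrow> real \<Rightarrow> real.
        (\<forall>x\<in>S. F 0 x = f x) \<and>
        (\<forall>n. \<forall>x\<in>S. (F n has_real_derivative F (Suc n) x) (at x within S)))"

end

theory Submission
  imports Defs "HOL-Computational_Algebra.Polynomial" "HOL-Real_Asymp.Real_Asymp"
begin

text \<open>
  On the diagonal \<open>u = v\<close> there are always the three roots \<open>0, a, 1\<close>.  Off the diagonal, replace the
  second equation by the difference quotient of the two and pass to the shifted sum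
  \<open>t = 6 (u + v) - 4 (1 + a)\<close>.  With \<open>x = 1 - 2 a\<close> the system becomes
  \<open>t^3 - 3 c t + 2 r^3 = 0\<close> and \<open>12 (u - v)^2 = 4 (3 + x^2) - 192 d - t^2\<close>, where
  \<open>c = 3 + x^2 - 72 d\<close> and \<open>r^3 = x (9 - x^2)\<close>.  The number of real \<open>t\<close> is governed by the sign of the
  discriminant \<open>c^3 - r^6\<close>, which changes at \<open>d_-(a) = (3 + x^2 - r^2) / 72\<close>; and each real \<open>t\<close> carries
  two roots \<open>(u, v)\<close> for \<open>d < d_+(a)\<close> and none for \<open>d \<ge> d_+(a)\<close>.  All analytic claims about \<open>d_-\<close> are
  read off its closed form.
\<close>

section \<open>Real roots of the cubic \<open>t^3 - 3 c t + 2 r^3\<close>\<close>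

definition cubic_roots :: "real \<Rightarrow> real \<Rightarrow> real set" where
  "cubic_roots c r = {t. t^3 - 3 * c * t + 2 * r^3 = 0}"

text \<open>Two distinct real roots make the third one real as well, so the discriminant
  \<open>108 (c^3 - r^6)\<close> cannot be negative. The contrapositive later gives uniqueness of
  the root.\<close>

lemma cubic_roots_no_two:
  assumes "t1 \<in> cubic_roots c r" "t2 \<in> cubic_roots c r" "t1 \<noteq> t2"
  shows "r^6 \<le> c^3"
proof -
  have f1: "t1^3 - 3 * c * t1 + 2 * r^3 = 0" and f2: "t2^3 - 3 * c * t2 + 2 * r^3 = 0"
    using assms by (auto simp: cubic_roots_def)
  have "(t1 - t2) * (t1^2 + t1 * t2 + t2^2 - 3 * c) = 0"
    using f1 f2 by algebra
  hence q: "3 * c = t1^2 + t1 * t2 + t2^2" using assms(3) by simp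
  have p: "2 * r^3 = t1 * t2 * (t1 + t2)"
    using f1 q by algebra
  have "108 * (c^3 - r^6) = 4 * (3 * c)^3 - 27 * (2 * r^3)^2"
    by algebra
  \<comment> \<open>the discriminant is a square, because the third root is \<open>- t1 - t2\<close>\<close>
  also have "\<dots> = ((t1 - t2) * (2 * t1 + t2) * (t1 + 2 * t2))^2"
    unfolding q p by algebra
  also have "\<dots> \<ge> 0" by simp
  finally show ?thesis by simp
qed

lemma cubic_roots_between:
  assumes "x \<le> y" "(x^3 - 3 * c * x + 2 * r^3) * (y^3 - 3 * c * y + 2 * r^3) < 0"
  shows "\<exists>t\<in>cubic_roots c r. x < t \<and> t < y"
proof -
  let ?f = "\<lambda>t. t^3 - 3 * c * t + 2 * r^3"
  have ct: "continuous_on {x..y} ?f" by (intro continuous_intros)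
  have "\<exists>t. x \<le> t \<and> t \<le> y \<and> ?f t = 0"
  proof (cases "?f x < 0")
    case True
    thus ?thesis using IVT'[of ?f x 0 y] assms ct by (auto simp: mult_less_0_iff)
  next
    case False
    thus ?thesis using IVT2'[of ?f y 0 x] assms ct by (auto simp: mult_less_0_iff)
  qed
  then obtain t where t: "x \<le> t" "t \<le> y" "?f t = 0" by blast
  moreover have "t \<noteq> x" "t \<noteq> y" using t assms(2) by auto
  ultimately show ?thesis by (auto simp: cubic_roots_def intro!: bexI[of _ t])
qed

text \<open>Intermediate values at the critical points \<open>-q\<close>, \<open>q\<close> and at
  \<open>-2q\<close>, \<open>2q\<close> with \<open>q = sqrt c\<close> give three roots; Vieta's
  relations exclude a fourth.\<close>

lemma cubic_roots_three:
  assumes "r^2 < c" "0 \<le> r"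
  shows "card (cubic_roots c r) = 3"
proof -
  define q where "q = sqrt c"
  have c: "c = q^2" using assms by (simp add: q_def order_trans[OF zero_le_power2 less_imp_le])
  have qr: "r < q" using assms by (simp add: q_def real_less_rsqrt)
  have q3: "r^3 < q^3" using qr assms by (intro power_strict_mono) auto
  have r3: "0 \<le> r^3" using assms by simp
  \<comment> \<open>The values at \<open>-2q\<close> and \<open>q\<close> agree, as do those at
    \<open>-q\<close> and \<open>2q\<close>; since \<open>0 \<le> r < q\<close>, their signs
    alternate.\<close>
  have v: "(-2*q)^3 - 3*c*(-2*q) + 2*r^3 = - 2*(q^3 - r^3)"
    "(-q)^3 - 3*c*(-q) + 2*r^3 = 2*(q^3 + r^3)"
    "q^3 - 3*c*q + 2*r^3 = - 2*(q^3 - r^3)"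
    "(2*q)^3 - 3*c*(2*q) + 2*r^3 = 2*(q^3 + r^3)"
    unfolding c by algebra+
  have pos: "0 < (q^3 - r^3) * (q^3 + r^3)" using q3 r3 by (intro mult_pos_pos) linarith+
  obtain t1 where t1: "t1 \<in> cubic_roots c r" "t1 < -q"
    using cubic_roots_between[of "-2*q" "-q" c r] unfolding v using pos qr assms by (auto simp: algebra_simps)
  obtain t2 where t2: "t2 \<in> cubic_roots c r" "-q < t2" "t2 < q"
    using cubic_roots_between[of "-q" "q" c r] unfolding v using pos qr assms by (auto simp: algebra_simps)
  obtain t3 where t3: "t3 \<in> cubic_roots c r" "q < t3"
    using cubic_roots_between[of "q" "2*q" c r] unfolding v using pos qr assms by (auto simp: algebra_simps)
  have ne: "t1 \<noteq> t2" "t1 \<noteq> t3" "t2 \<noteq> t3" using t1 t2 t3 qr assms by auto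
  have e: "t1^3 - 3 * c * t1 + 2 * r^3 = 0" "t2^3 - 3 * c * t2 + 2 * r^3 = 0" "t3^3 - 3 * c * t3 + 2 * r^3 = 0"
    using t1 t2 t3 by (auto simp: cubic_roots_def)
  \<comment> \<open>Dividing differences of the root equations by differences of the roots yields
    Vieta: the sum of the roots vanishes and the cubic factors.\<close>
  have "(t1 - t2) * (t1^2 + t1 * t2 + t2^2 - 3 * c) = 0" using e by algebra
  hence k1: "3 * c = t1^2 + t1 * t2 + t2^2" using ne by simp
  have "(t1 - t3) * (t1^2 + t1 * t3 + t3^2 - 3 * c) = 0" using e by algebra
  hence k2: "3 * c = t1^2 + t1 * t3 + t3^2" using ne by simp
  have "(t2 - t3) * (t1 + t2 + t3) = 0" using k1 k2 by algebra
  hence k3: "t3 = - t1 - t2" using ne by simp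
  have "t \<in> {t1, t2, t3}" if "t \<in> cubic_roots c r" for t
  proof -
    have "t^3 - 3 * c * t + 2 * r^3 = 0" using that by (simp add: cubic_roots_def)
    hence "(t - t1) * (t - t2) * (t - t3) = 0" using e(1) k1 k3 by algebra
    thus ?thesis by auto
  qed
  hence "cubic_roots c r = {t1, t2, t3}" using t1 t2 t3 by auto
  thus ?thesis using ne by simp
qed

text \<open>At zero discriminant \<open>r\<close> is a double root. For \<open>r = 0\<close> the two
  listed roots coincide, which makes \<open>a = 1/2\<close> exceptional at
  \<open>d = d_minus a\<close>.\<close>

lemma cubic_roots_double: "cubic_roots (r^2) r = {r, -2 * r}"
proof -
  have "t^3 - 3 * r^2 * t + 2 * r^3 = (t - r)^2 * (t + 2 * r)" for t by algebra
  thus ?thesis by (auto simp: cubic_roots_def)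
qed

lemma root_3_cube [simp]: "root 3 (y^3) = y"
  by (rule odd_real_root_power_cancel) simp

text \<open>The cubic tends to minus infinity at minus infinity, so the intermediate value theorem
  applies to the left of \<open>b\<close>.\<close>

lemma cubic_root_le:
  fixes b c e :: real
  assumes "0 \<le> b^3 - 3 * c * b + e"
  shows "\<exists>z\<le>b. z^3 - 3 * c * z + e = 0"
proof -
  let ?f = "\<lambda>z. z^3 - 3 * c * z + e"
  have "filterlim ?f at_bot at_bot" by real_asymp
  hence "eventually (\<lambda>s. ?f s \<le> 0) at_bot" by (simp add: filterlim_at_bot)
  hence "eventually (\<lambda>s. ?f s \<le> 0 \<and> s \<le> b) at_bot"
    by (intro eventually_conj eventually_le_at_bot)
  then obtain s where s: "?f s \<le> 0" "s \<le> b"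
    unfolding eventually_at_bot_linorder by blast
  have "continuous_on {s..b} ?f" by (intro continuous_intros)
  with IVT'[of ?f s 0 b] s assms obtain z where "z \<le> b" "?f z = 0" by metis
  thus ?thesis by blast
qed

lemma cubic_roots_unique:
  assumes "c < r^2"
  obtains t where "cubic_roots c r = {t}"
proof -
  have "filterlim (\<lambda>t. t^3 - 3 * c * t + 2 * r^3) at_top at_top" by real_asymp
  hence "eventually (\<lambda>t. 0 \<le> t^3 - 3 * c * t + 2 * r^3) at_top"
    by (simp add: filterlim_at_top)
  then obtain b where "0 \<le> b^3 - 3 * c * b + 2 * r^3"
    by (auto simp: eventually_at_top_linorder)
  then obtain t where t: "t \<in> cubic_roots c r"
    using cubic_root_le[of b c "2 * r^3"] unfolding cubic_roots_def by blast
  have "c^3 < r^6"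
  proof -
    \<comment> \<open>\<open>c\<close> may be negative, so cubing is compared through
      \<open>root 3\<close>, which is increasing on all of the reals.\<close>
    have "root 3 (c^3) < root 3 ((r^2)^3)" using assms by (simp only: root_3_cube)
    hence "c^3 < (r^2)^3" by (simp only: real_root_less_iff zero_less_numeral)
    thus ?thesis by (simp add: power_mult[symmetric])
  qed
  hence "s = t" if "s \<in> cubic_roots c r" for s
    using cubic_roots_no_two[OF that t] by linarith
  hence "cubic_roots c r = {t}" using t by blast
  thus ?thesis by (rule that)
qed

section \<open>Off-diagonal roots in terms of the shifted sum \<open>t\<close>\<close>

definition sum_cubic :: "real \<Rightarrow> real \<Rightarrow> real \<Rightarrow> real" where
  "sum_cubic x d t = t^3 - 3 * (3 + x^2 - 72 * d) * t + 2 * (x * (9 - x^2))"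

text \<open>The value of \<open>t^2 + 12 (u - v)^2\<close> at an off-diagonal root; hence
  \<open>t\<close> comes from real \<open>u \<noteq> v\<close> only if
  \<open>t^2 < sum_bound x d\<close>.\<close>

definition sum_bound :: "real \<Rightarrow> real \<Rightarrow> real" where
  "sum_bound x d = 4 * (3 + x^2) - 192 * d"

lemma offdiag_root_iff:
  assumes "u \<noteq> v" "x = 1 - 2 * a" "t = 6 * (u + v) - 4 * (1 + a)"
  shows "G u v a d = 0 \<longleftrightarrow> sum_cubic x d t = 0 \<and> 12 * (u - v)^2 = sum_bound x d - t^2"
proof -
  define S where "S = g u a + g v a"
  define Q where "Q = - (u^2 + u * v + v^2) + (1 + a) * (u + v) - a - 4 * d"
  have D: "g u a - g v a - 4 * d * (u - v) = (u - v) * Q"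
    unfolding g_def Q_def by algebra
  have "G u v a d = 0 \<longleftrightarrow> S = 0 \<and> g u a - g v a - 4 * d * (u - v) = 0"
    unfolding G_def S_def by (auto simp: prod_eq_iff algebra_simps)
  also have "\<dots> \<longleftrightarrow> S = 0 \<and> Q = 0" unfolding D using assms(1) by simp
  finally have 1: "G u v a d = 0 \<longleftrightarrow> S = 0 \<and> Q = 0" .
  \<comment> \<open>The two target equations are combinations of \<open>S\<close> and
    \<open>Q\<close> with a triangular, invertible coefficient matrix.\<close>
  have 2: "12 * (u - v)^2 - (sum_bound x d - t^2) = - 48 * Q"
    unfolding Q_def sum_bound_def assms(2,3) by algebra
  have 3: "sum_cubic x d t = 108 * S - 54 * t * Q"
    unfolding Q_def S_def sum_cubic_def assms(2,3) g_def by algebra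
  show ?thesis unfolding 1 using 2 3 by auto
qed

lemma diag_roots:
  assumes "0 < a" "a < 1"
  shows "{p \<in> G_roots a d. fst p = snd p} = {(0, 0), (a, a), (1, 1)}"
  using assms by (auto simp: G_roots_def G_def g_def prod_eq_iff)

text \<open>Each admissible \<open>t\<close> fixes \<open>u + v\<close> and the absolute value of
  \<open>u - v\<close>; the sign of \<open>u - v\<close> remains free. So it carries exactly two
  off-diagonal roots, besides the three diagonal ones.\<close>

lemma card_G_roots:
  fixes a d :: real
  defines "x \<equiv> 1 - 2 * a"
  defines "T \<equiv> {t. sum_cubic x d t = 0 \<and> t^2 < sum_bound x d}"
  assumes a: "0 < a" "a < 1" and fin: "finite T"
  shows "card (G_roots a d) = 3 + 2 * card T"
proof -
  define D where "D = {p \<in> G_roots a d. fst p = snd p}"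
  define O' where "O' = {p \<in> G_roots a d. fst p \<noteq> snd p}"
  define w where "w = (\<lambda>t. sqrt ((sum_bound x d - t^2) / 12))"
  \<comment> \<open>\<open>\<phi>\<close> solves for \<open>(u, v)\<close> from \<open>t\<close> and
    the sign \<open>b\<close> of \<open>u - v\<close>; \<open>\<psi>\<close> reads these data
    back.\<close>
  define \<phi> where "\<phi> = (\<lambda>(t :: real, b :: real).
     ((t + 4 * (1 + a)) / 12 + b * w t / 2, (t + 4 * (1 + a)) / 12 - b * w t / 2))"
  define \<psi> where "\<psi> = (\<lambda>(u :: real, v :: real). (6 * (u + v) - 4 * (1 + a), sgn (u - v)))"
  have wpos: "w t > 0" if "t \<in> T" for t using that by (simp add: w_def T_def)
  have w2: "12 * (w t)^2 = sum_bound x d - t^2" if "t \<in> T" for t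
    using that by (simp add: w_def T_def)
  have off: "(u, v) \<in> O' \<longleftrightarrow> u \<noteq> v \<and> sum_cubic x d (6 * (u + v) - 4 * (1 + a)) = 0 \<and>
     12 * (u - v)^2 = sum_bound x d - (6 * (u + v) - 4 * (1 + a))^2" for u v
    using offdiag_root_iff[of u v x a _ d] by (auto simp: O'_def G_roots_def x_def)
  have "bij_betw \<phi> (T \<times> {-1, 1}) O'"
  proof (rule bij_betw_byWitness[of _ \<psi>])
    show "\<forall>p\<in>T \<times> {-1, 1}. \<psi> (\<phi> p) = p"
    proof
      fix p :: "real \<times> real" assume "p \<in> T \<times> {-1, 1}"
      then obtain t b :: real where p: "p = (t, b)" and t: "t \<in> T" and b: "b \<in> {-1, 1}" by blast
      have "sgn (b * (w t * 12)) = b" using wpos[OF t] b by (auto simp: sgn_mult)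
      moreover have "sgn (b * w t) = sgn (b * (w t * 12))" by (simp add: sgn_mult)
      ultimately show "\<psi> (\<phi> p) = p" unfolding p by (simp add: \<phi>_def \<psi>_def field_simps)
    qed
    show "\<phi> ` (T \<times> {-1, 1}) \<subseteq> O'"
    proof (rule image_subsetI)
      fix p :: "real \<times> real" assume "p \<in> T \<times> {-1, 1}"
      then obtain t b :: real where p: "p = (t, b)" and t: "t \<in> T" and b: "b \<in> {-1, 1}" by blast
      obtain u v where uv: "\<phi> (t, b) = (u, v)" by fastforce
      have s: "6 * (u + v) - 4 * (1 + a) = t" and d: "u - v = b * w t"
        using uv by (auto simp: \<phi>_def field_simps)
      have "(u - v)^2 = (w t)^2" using b unfolding d by (auto simp: power_mult_distrib)
      moreover have "u \<noteq> v" using d b wpos[OF t] by auto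
      ultimately have "(u, v) \<in> O'" unfolding off s using t w2[OF t] by (simp add: T_def)
      thus "\<phi> p \<in> O'" by (simp add: p uv)
    qed
    have *: "6 * (u + v) - 4 * (1 + a) \<in> T" "w (6 * (u + v) - 4 * (1 + a)) = \<bar>u - v\<bar>" if "(u, v) \<in> O'" for u v
    proof -
      note o = that[unfolded off]
      have "(u - v)^2 > 0" using o by simp
      thus "6 * (u + v) - 4 * (1 + a) \<in> T" 
        using o unfolding T_def by (simp only: mem_Collect_eq) linarith
      have "(sum_bound x d - (6 * (u + v) - 4 * (1 + a))^2) / 12 = (u - v)^2" using o by simp
      thus "w (6 * (u + v) - 4 * (1 + a)) = \<bar>u - v\<bar>" by (simp add: w_def)
    qed
    show "\<psi> ` O' \<subseteq> T \<times> {-1, 1}"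
    proof (rule image_subsetI)
      fix p assume "p \<in> O'"
      then obtain u v where p: "p = (u, v)" and uv: "(u, v) \<in> O'" by (cases p) auto
      have "u \<noteq> v" using uv off by blast
      hence "sgn (u - v) \<in> {-1, 1}" by (auto simp: sgn_if)
      thus "\<psi> p \<in> T \<times> {-1, 1}" using *(1)[OF uv] by (simp add: p \<psi>_def)
    qed
    show "\<forall>p\<in>O'. \<phi> (\<psi> p) = p"
    proof safe
      fix u v assume uv: "(u, v) \<in> O'"
      have "sgn (u - v) * \<bar>u - v\<bar> = u - v" by (simp add: sgn_mult_abs)
      thus "\<phi> (\<psi> (u, v)) = (u, v)" using *(2)[OF uv]
        by (simp add: \<phi>_def \<psi>_def field_simps)
    qed
  qed
  hence cO: "card O' = card T * 2" and fO: "finite O'"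
    using fin bij_betw_same_card bij_betw_finite by (fastforce simp: card_cartesian_product)+
  have "card D = 3" "finite D" unfolding D_def diag_roots[OF a] using a by auto
  moreover have "G_roots a d = D \<union> O'" "D \<inter> O' = {}" by (auto simp: D_def O'_def)
  ultimately show ?thesis using cO fO by (simp add: card_Un_disjoint)
qed

section \<open>Which roots \<open>t\<close> satisfy \<open>t^2 < sum_bound x d\<close>\<close>

text \<open>Write \<open>E = sum_bound x d\<close> and \<open>c = 3 + x^2 - 72 d\<close>. Then
  \<open>E - 3 c = 3 + x^2 + 24 d\<close>, so the left side is \<open>E (E - 3 c)^2\<close>, to be
  compared with \<open>t^2 (t^2 - 3 c)^2\<close>. The right side shows how it decreases in
  \<open>d\<close>.\<close>

lemma sum_bound_mult:
  "sum_bound x d * (3 + x^2 + 24 * d)^2 =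
    4 * ((3 + x^2)^3 - 3 * (3 + x^2) * (24 * d)^2 - 2 * (24 * d)^3)"
  unfolding sum_bound_def by algebra

text \<open>This \<open>d\<close> is \<open>d_+(a)\<close>: there \<open>t = -4 x\<close> is a root
  with \<open>t^2 = sum_bound x d\<close>, so an off-diagonal pair has merged with
  \<open>(a, a)\<close>.\<close>

lemma sum_bound_mult_dp:
  assumes "d = (1 - x^2) / 16"
  shows "sum_bound x d * (3 + x^2 + 24 * d)^2 = 4 * (x * (9 - x^2))^2"
proof -
  have "sum_bound x d = 16 * x^2" "3 + x^2 + 24 * d = (9 - x^2) / 2"
    by (auto simp: assms sum_bound_def field_simps)
  thus ?thesis by algebra
qed

lemma sum_bound_mult_strict_antimono:
  assumes "0 \<le> d" "d < e"
  shows "sum_bound x e * (3 + x^2 + 24 * e)^2 < sum_bound x d * (3 + x^2 + 24 * d)^2"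
proof -
  have "(24 * d)^2 < (24 * e)^2" "(24 * d)^3 < (24 * e)^3"
    using assms by (auto intro!: power_strict_mono)
  moreover from this have "3 * (3 + x^2) * (24 * d)^2 < 3 * (3 + x^2) * (24 * e)^2"
    by (intro mult_strict_left_mono) (auto simp: add_pos_nonneg)
  ultimately show ?thesis unfolding sum_bound_mult
    by (intro mult_strict_left_mono) linarith+
qed

lemma sum_cubic_root_lt_bound:
  assumes "sum_cubic x d t = 0" "0 \<le> d" "d < (1 - x^2) / 16"
  shows "t^2 < sum_bound x d"
proof (rule ccontr)
  let ?E = "sum_bound x d" and ?c = "3 + x^2 - 72 * d"
  assume "\<not> t^2 < ?E"
  hence ge: "?E \<le> t^2" by simp
  have m: "?E - 3 * ?c = 3 + x^2 + 24 * d" by (simp add: sum_bound_def)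
  have mpos: "3 + x^2 + 24 * d > 0" using assms by (simp add: add_pos_nonneg)
  \<comment> \<open>\<open>T (T - 3c)^2\<close> increases for \<open>T \<ge> E > 3c\<close> and equals \<open>4 (x (9 - x^2))^2\<close> at \<open>T = t^2\<close>\<close>
  have "4 * (x * (9 - x^2))^2 < ?E * (?E - 3 * ?c)^2"
    using sum_bound_mult_strict_antimono[OF assms(2,3)] sum_bound_mult_dp[OF refl] unfolding m by metis
  also have "\<dots> \<le> t^2 * (t^2 - 3 * ?c)^2"
    using ge m mpos by (intro mult_mono power_mono) auto
  also have "\<dots> = 4 * (x * (9 - x^2))^2"
  proof -
    have "t * (t^2 - 3 * ?c) = - 2 * (x * (9 - x^2))" using assms(1) unfolding sum_cubic_def by algebra
    hence "(t * (t^2 - 3 * ?c))^2 = (- 2 * (x * (9 - x^2)))^2" by simp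
    thus ?thesis by (simp add: power_mult_distrib)
  qed
  finally show False by simp
qed

text \<open>From \<open>d_+\<close> on, the comparison of \<open>E (E - 3 c)^2\<close> with
  \<open>4 (x (9 - x^2))^2\<close> is reversed. For positive \<open>E\<close> and
  \<open>x \<ge> 0\<close> this makes the cubic nonnegative at \<open>- sqrt E\<close>, which
  locates its only root.\<close>

lemma sum_cubic_root_ge_bound:
  assumes x: "0 \<le> x" "x \<le> 1" and d: "(1 - x^2) / 16 \<le> d"
    and uniq: "\<And>s. sum_cubic x d s = 0 \<Longrightarrow> s = t"
  shows "sum_bound x d \<le> t^2"
proof (cases "sum_bound x d \<le> 0")
  case True
  thus ?thesis by (meson order_trans zero_le_power2)
next
  case False
  let ?E = "sum_bound x d" and ?c = "3 + x^2 - 72 * d"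
  define q where "q = sqrt ?E"
  have q: "q > 0" "q^2 = ?E" using False by (auto simp: q_def)
  have x2: "x^2 \<le> 1" using x by (simp add: power_le_one)
  have h: "0 \<le> x * (9 - x^2)" using x x2 by (intro mult_nonneg_nonneg) auto
  have "?E * (3 + x^2 + 24 * d)^2 \<le> 4 * (x * (9 - x^2))^2"
  proof (cases "d = (1 - x^2) / 16")
    case True
    thus ?thesis using sum_bound_mult_dp by simp
  next
    case False
    hence "(1 - x^2) / 16 < d" "0 \<le> (1 - x^2) / 16" using d x2 by auto
    from sum_bound_mult_strict_antimono[OF this(2,1), of x] sum_bound_mult_dp[OF refl, of x]
    show ?thesis by linarith
  qed
  hence "(q * (3 + x^2 + 24 * d))^2 \<le> (2 * (x * (9 - x^2)))^2"
    by (simp add: power_mult_distrib q(2))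
  hence le: "q * (3 + x^2 + 24 * d) \<le> 2 * (x * (9 - x^2))"
    by (rule power2_le_imp_le) (use h in simp)
  have "sum_cubic x d (-q) = 2 * (x * (9 - x^2)) - q * (q^2 - 3 * ?c)"
    unfolding sum_cubic_def by algebra
  also have "q^2 - 3 * ?c = 3 + x^2 + 24 * d" unfolding q(2) by (simp add: sum_bound_def)
  finally have up: "sum_cubic x d (-q) \<ge> 0" using le by simp
  \<comment> \<open>so the unique root lies to the left of \<open>- sqrt E\<close>\<close>
  then obtain z where "z \<le> -q" "sum_cubic x d z = 0"
    using cubic_root_le unfolding sum_cubic_def by blast
  hence "q \<le> -t" using uniq by force
  hence "q^2 \<le> (-t)^2" using q(1) by (intro power_mono) auto
  thus ?thesis using q(2) by simp
qed

text \<open>\<open>g (1 - u) (1 - a) = - g u a\<close>, so reflecting both coordinates only changes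
  the sign of \<open>G\<close>. This reduces the count to \<open>a \<le> 1/2\<close>, that is
  \<open>x \<ge> 0\<close>.\<close>

lemma card_G_roots_reflect: "card (G_roots (1 - a) d) = card (G_roots a d)"
proof -
  have "bij_betw (\<lambda>(u, v). (1 - u, 1 - v)) (G_roots a d) (G_roots (1 - a) d)"
    by (rule bij_betw_byWitness[of _ "\<lambda>(u, v). (1 - u, 1 - v)"])
       (auto simp: G_roots_def G_def g_def prod_eq_iff algebra_simps)
  thus ?thesis by (simp add: bij_betw_same_card)
qed

section \<open>The functions \<open>d_minus\<close> and \<open>d_plus\<close>\<close>

definition curt :: "real \<Rightarrow> real" where
  "curt x = root 3 (x * (9 - x^2))"

definition d_minus :: "real \<Rightarrow> real" where
  "d_minus a = (3 + (1 - 2 * a)^2 - (curt (1 - 2 * a))^2) / 72"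

definition d_plus :: "real \<Rightarrow> real" where
  "d_plus a = a * (1 - a) / 4"

lemma d_plus_reflect: "d_plus a = d_plus (1 - a)"
  by (simp add: d_plus_def mult.commute)

lemma curt_cubed: "curt x ^ 3 = x * (9 - x^2)"
  by (simp add: curt_def odd_real_root_pow)

lemma curt_minus: "curt (- x) = - curt x"
  by (simp add: curt_def real_root_minus[symmetric])

lemma curt_0 [simp]: "curt 0 = 0"
  by (simp add: curt_def)

lemma curt_1 [simp]: "curt 1 = 2"
  using root_3_cube[of 2] by (simp add: curt_def)

lemma curt_strict_mono:
  assumes "0 \<le> x" "x < y" "y \<le> 1"
  shows "curt x < curt y"
proof -
  have "x^2 \<le> 1" "y^2 \<le> 1" "x * y \<le> 1" using assms by (auto simp: power_le_one mult_le_one)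
  hence "0 < (y - x) * (9 - (x^2 + x * y + y^2))" using assms by (intro mult_pos_pos) auto
  also have "\<dots> = y * (9 - y^2) - x * (9 - x^2)" by algebra
  finally show ?thesis unfolding curt_def by (intro real_root_less_mono) auto
qed

text \<open>On the unit interval \<open>8 x^3 \<le> 8 x \<le> x (9 - x^2) \<le> 8\<close>; take cube
  roots.\<close>

lemma curt_bounds:
  assumes "0 \<le> x" "x \<le> 1"
  shows "2 * x \<le> curt x" "curt x \<le> 2"
proof -
  have x2: "x^2 \<le> 1" using assms by (simp add: power_le_one)
  have "(2 * x)^3 = 8 * x * x^2" by algebra
  also have "\<dots> \<le> 8 * x * 1" using assms x2 by (intro mult_left_mono) auto
  also have "\<dots> = x * 8" by simp
  also have "\<dots> \<le> x * (9 - x^2)" using assms x2 by (intro mult_left_mono) auto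
  finally have "root 3 ((2 * x)^3) \<le> root 3 (x * (9 - x^2))" by simp
  thus "2 * x \<le> curt x" by (simp only: curt_def root_3_cube)
  show "curt x \<le> 2" using curt_strict_mono[of x 1] assms by (cases "x = 1") auto
qed

text \<open>This is the monotonicity of \<open>d_minus\<close> on the left half. With
  \<open>r = curt x\<close> and \<open>s = curt y\<close>,
  \<open>6 (y - x) \<le> s^3 - r^3 \<le> 3 (s^2 - r^2)\<close>, while
  \<open>y^2 - x^2 < 2 (y - x)\<close>. Differences are used because \<open>curt\<close> has a
  vertical tangent at 0.\<close>

lemma curt_sq_diff:
  assumes "0 \<le> x" "x < y" "y \<le> 1"
  shows "y^2 - x^2 < (curt y)^2 - (curt x)^2"
proof -
  let ?r = "curt x" and ?s = "curt y"
  have r: "0 \<le> ?r" "?r \<le> 2" "?s \<le> 2" "?r < ?s"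
    using curt_bounds[of x] curt_bounds[of y] curt_strict_mono assms by auto
  have xy: "x^2 \<le> 1" "y^2 \<le> 1" "x * y \<le> 1" using assms by (auto simp: power_le_one mult_le_one)
  have "6 * (y - x) \<le> (9 - (x^2 + x * y + y^2)) * (y - x)"
    using assms xy by (intro mult_right_mono) auto
  also have "\<dots> = ?s^3 - ?r^3" unfolding curt_cubed by algebra
  also have "\<dots> = (?s - ?r) * (?r * ?r + ?r * ?s + ?s * ?s)" by algebra
  also have "\<dots> \<le> (?s - ?r) * (3 * (?r + ?s))"
  proof (intro mult_left_mono)
    \<comment> \<open>Since \<open>r\<close> and \<open>s\<close> lie in \<open>[0, 2]\<close>, each
      square is at most twice its base and \<open>r s \<le> r + s\<close>.\<close>
    have "?r * ?r \<le> ?r * 2" "?s * ?s \<le> ?s * 2" "?r * ?s \<le> ?r * 2" "?r * ?s \<le> 2 * ?s"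
      using r by (auto intro!: mult_left_mono mult_right_mono)
    thus "?r * ?r + ?r * ?s + ?s * ?s \<le> 3 * (?r + ?s)" by argo
  qed (use r in simp)
  also have "\<dots> = 3 * (?s^2 - ?r^2)" by algebra
  finally have "2 * (y - x) \<le> ?s^2 - ?r^2" by simp
  moreover have "y^2 - x^2 = (y - x) * (x + y)" by algebra
  moreover have "(y - x) * (x + y) < (y - x) * 2"
    using assms by (intro mult_strict_left_mono) auto
  ultimately show ?thesis by simp
qed

lemma d_minus_reflect: "d_minus (1 - a) = d_minus a"
proof -
  have "1 - 2 * (1 - a) = - (1 - 2 * a)" by simp
  thus ?thesis by (simp only: d_minus_def curt_minus power2_minus)
qed

lemma d_minus_values [simp]: "d_minus 0 = 0" "d_minus 1 = 0" "d_minus (1/2) = 1/24"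
  using curt_minus[of 1] by (simp_all add: d_minus_def)

lemma continuous_on_d_minus: "continuous_on S d_minus"
  unfolding d_minus_def curt_def by (intro continuous_intros) auto

lemma d_minus_strict_mono: "strict_mono_on {0..1/2} d_minus"
proof (rule strict_mono_onI)
  fix a b :: real assume "a \<in> {0..1/2}" "b \<in> {0..1/2}" "a < b"
  thus "d_minus a < d_minus b"
    using curt_sq_diff[of "1 - 2 * b" "1 - 2 * a"] by (simp add: d_minus_def)
qed

lemma d_minus_strict_antimono: "strict_antimono_on {1/2..1} d_minus"
proof (rule monotone_onI)
  fix a b :: real assume "a \<in> {1/2..1}" "b \<in> {1/2..1}" "a < b"
  thus "d_minus a > d_minus b"
    using strict_mono_onD[OF d_minus_strict_mono, of "1 - b" "1 - a"] by (simp add: d_minus_reflect)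
qed

lemma d_minus_bij: "bij_betw d_minus {0..1/2} {0..1/24}"
  unfolding bij_betw_def
proof
  show "inj_on d_minus {0..1/2}" using d_minus_strict_mono by (rule strict_mono_on_imp_inj_on)
  show "d_minus ` {0..1/2} = {0..1/24}"
  proof (intro equalityI subsetI)
    fix y assume "y \<in> d_minus ` {0..1/2}"
    then obtain a where a: "y = d_minus a" "0 \<le> a" "a \<le> 1/2" by auto
    have "mono_on {0..1/2} d_minus" using d_minus_strict_mono by (rule strict_mono_on_imp_mono_on)
    hence "d_minus 0 \<le> d_minus a" "d_minus a \<le> d_minus (1/2)"
      using a mono_onD[of _ d_minus 0 a] mono_onD[of _ d_minus a "1/2"] by auto
    thus "y \<in> {0..1/24}" using a by simp
  next
    fix y :: real assume "y \<in> {0..1/24}"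
    then obtain a where "0 \<le> a" "a \<le> 1/2" "d_minus a = y"
      using IVT'[of d_minus 0 y "1/2"] continuous_on_d_minus by auto
    thus "y \<in> d_minus ` {0..1/2}" by auto
  qed
qed

lemma d_minus_nonneg:
  assumes "0 \<le> a" "a \<le> 1"
  shows "0 \<le> d_minus a"
proof (cases "a \<le> 1/2")
  case True
  thus ?thesis using bij_betw_apply[OF d_minus_bij, of a] assms by simp
next
  case False
  thus ?thesis using bij_betw_apply[OF d_minus_bij, of "1 - a"] assms by (simp add: d_minus_reflect)
qed

text \<open>For \<open>a \<le> 1/2\<close>, the bound \<open>2 x \<le> curt x\<close> gives
  \<open>72 d_minus a \<le> 3 (1 - x^2)\<close>, whereas \<open>72 d_plus a = 9/2 (1 - x^2)\<close>.
  Reflection covers the other half.\<close>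

lemma d_minus_less_d_plus:
  assumes "0 < a" "a < 1"
  shows "d_minus a < d_plus a"
proof -
  have *: "d_minus a < d_plus a" if "0 < a" "a \<le> 1/2" for a
  proof -
    let ?x = "1 - 2 * a"
    have "?x^2 < 1" using that by (simp add: abs_square_less_1)
    moreover have "(2 * ?x)^2 \<le> (curt ?x)^2"
      using curt_bounds[of ?x] that by (intro power_mono) auto
    moreover have "d_plus a = (1 - ?x^2) / 16" by (simp add: d_plus_def power2_eq_square field_simps)
    moreover have "(2 * ?x)^2 = 4 * ?x^2" by algebra
    ultimately have "2 * (3 + ?x^2 - (curt ?x)^2) < 144 * d_plus a" by argo
    thus ?thesis by (simp add: d_minus_def)
  qed
  show ?thesis using *[of a] *[of "1 - a"] assms
    by (cases "a \<le> 1/2") (auto simp: d_minus_reflect d_plus_def mult.commute)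
qed

section \<open>Counting the roots of \<open>G\<close>\<close>

text \<open>The constraint on \<open>t\<close> is all or nothing: every real root of the cubic is
  admissible below \<open>d_plus a\<close>, and none from there on.\<close>

lemma card_G_roots_left:
  fixes a d :: real
  defines "x \<equiv> 1 - 2 * a"
  defines "C \<equiv> cubic_roots (3 + x^2 - 72 * d) (curt x)"
  assumes a: "0 < a" "a \<le> 1/2" and fin: "finite C"
  shows "0 \<le> d \<Longrightarrow> d < d_plus a \<Longrightarrow> card (G_roots a d) = 3 + 2 * card C"
    and "d_plus a \<le> d \<Longrightarrow> card (G_roots a d) = 3"
proof -
  have C: "C = {t. sum_cubic x d t = 0}"
    unfolding C_def cubic_roots_def sum_cubic_def curt_cubed by simp
  have dp: "d_plus a = (1 - x^2) / 16" by (simp add: x_def d_plus_def power2_eq_square field_simps)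
  have x: "0 \<le> x" "x \<le> 1" using a by (auto simp: x_def)
  define T where "T = {t. sum_cubic x d t = 0 \<and> t^2 < sum_bound x d}"
  have "finite T" by (rule finite_subset[OF _ fin]) (auto simp: C T_def)
  hence card: "card (G_roots a d) = 3 + 2 * card T"
    using card_G_roots[of a d] a by (simp add: T_def x_def)
  show "card (G_roots a d) = 3 + 2 * card C" if d: "0 \<le> d" "d < d_plus a"
  proof -
    have "T = C" using sum_cubic_root_lt_bound d unfolding T_def C dp by blast
    thus ?thesis using card by simp
  qed
  show "card (G_roots a d) = 3" if d: "d_plus a \<le> d"
  proof -
    \<comment> \<open>Beyond \<open>d_minus a\<close> the discriminant is negative, which supplies
      the uniqueness that the comparison with \<open>sum_bound\<close> requires.\<close>
    have "d_minus a < d" using d d_minus_less_d_plus[of a] a by simp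
    hence "3 + x^2 - 72 * d < (curt x)^2" by (simp add: d_minus_def x_def)
    then obtain t where "C = {t}" unfolding C_def by (rule cubic_roots_unique)
    hence t: "s = t" if "sum_cubic x d s = 0" for s using that C by auto
    have "T = {}"
    proof (rule ccontr)
      assume "T \<noteq> {}"
      then obtain s where s: "sum_cubic x d s = 0" "s^2 < sum_bound x d" by (auto simp: T_def)
      show False using sum_cubic_root_ge_bound[OF x, of d t] d t s unfolding dp by fastforce
    qed
    thus ?thesis using card by simp
  qed
qed

lemma card_G_roots_cases:
  assumes "0 < a" "a < 1"
  shows "0 \<le> d \<Longrightarrow> d < d_minus a \<Longrightarrow> card (G_roots a d) = 9"
    and "d_minus a < d \<Longrightarrow> d < d_plus a \<Longrightarrow> card (G_roots a d) = 5"
    and "d_plus a \<le> d \<Longrightarrow> card (G_roots a d) = 3"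
    and "a \<noteq> 1/2 \<Longrightarrow> card (G_roots a (d_minus a)) = 7"
    and "a = 1/2 \<Longrightarrow> card (G_roots a (d_minus a)) = 5"
proof -
  have *: "(0 \<le> d \<longrightarrow> d < d_minus a \<longrightarrow> card (G_roots a d) = 9) \<and>
     (d_minus a < d \<longrightarrow> d < d_plus a \<longrightarrow> card (G_roots a d) = 5) \<and>
     (d_plus a \<le> d \<longrightarrow> card (G_roots a d) = 3) \<and>
     card (G_roots a (d_minus a)) = (if a = 1/2 then 5 else 7)"
    if a: "0 < a" "a \<le> 1/2" for a d
  proof -
    let ?x = "1 - 2 * a"
    let ?C = "\<lambda>d. cubic_roots (3 + ?x^2 - 72 * d) (curt ?x)"
    have r: "0 \<le> curt ?x" "a \<noteq> 1/2 \<Longrightarrow> 0 < curt ?x" using curt_bounds(1)[of ?x] a by auto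
    have dp: "d_minus a < d_plus a" and dn: "0 \<le> d_minus a"
      using d_minus_less_d_plus d_minus_nonneg a by auto
    have 3: "card (?C d) = 3" if "d < d_minus a"
      using that r by (intro cubic_roots_three) (auto simp: d_minus_def)
    have 1: "\<exists>t. ?C d = {t}" if "d_minus a < d"
      by (rule cubic_roots_unique[of "3 + ?x^2 - 72 * d" "curt ?x"]) (use that in \<open>auto simp: d_minus_def\<close>)
    have "3 + ?x^2 - 72 * d_minus a = (curt ?x)^2" unfolding d_minus_def by argo
    hence 2: "?C (d_minus a) = {curt ?x, - 2 * curt ?x}" by (simp only: cubic_roots_double)
    have "card (?C (d_minus a)) = (if a = 1/2 then 1 else 2)" unfolding 2
    proof (cases "a = 1/2")
      case True
      hence "?x = 0" by simp
      thus "card {curt ?x, - 2 * curt ?x} = (if a = 1/2 then 1 else 2)"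
        using True by (simp only: curt_0) simp
    qed (use r in auto)
    hence "card (G_roots a (d_minus a)) = (if a = 1/2 then 5 else 7)"
      using card_G_roots_left(1)[of a "d_minus a"] 2 a dp dn by simp
    moreover have "card (G_roots a d) = 9" if d: "0 \<le> d" "d < d_minus a"
    proof -
      have "finite (?C d)" using 3[OF d(2)] by (intro card_ge_0_finite) simp
      thus ?thesis using card_G_roots_left(1)[of a d] 3[OF d(2)] a d dp by simp
    qed
    moreover have "card (G_roots a d) = 5" if d: "d_minus a < d" "d < d_plus a"
      using card_G_roots_left(1)[of a d] 1[OF d(1)] a d dn by auto
    moreover have "card (G_roots a d) = 3" if d: "d_plus a \<le> d"
    proof -
      have "finite (?C d)" using 1 d dp by fastforce
      thus ?thesis using card_G_roots_left(2)[of a d] a d by simp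
    qed
    ultimately show ?thesis by (intro conjI impI)
  qed
  \<comment> \<open>\<open>b\<close> is the representative of \<open>a\<close> and
    \<open>1 - a\<close> in the left half; counts and both thresholds are invariant under the
    reflection.\<close>
  define b where "b = (if a \<le> 1/2 then a else 1 - a)"
  have b: "0 < b" "b \<le> 1/2" "d_minus b = d_minus a" "d_plus b = d_plus a" "b = 1/2 \<longleftrightarrow> a = 1/2"
    "\<And>d. card (G_roots b d) = card (G_roots a d)"
    using assms by (auto simp: b_def d_minus_reflect d_plus_def card_G_roots_reflect mult.commute)
  note ** = *[OF b(1,2), unfolded b(3-6)]
  show "card (G_roots a d) = 9" if "0 \<le> d" "d < d_minus a" using **[of d] that by simp
  show "card (G_roots a d) = 5" if "d_minus a < d" "d < d_plus a" using **[of d] that by simp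
  show "card (G_roots a d) = 3" if "d_plus a \<le> d" using **[of d] that by simp
  show "card (G_roots a (d_minus a)) = 7" if "a \<noteq> 1/2" using **[of d] that by simp
  show "card (G_roots a (d_minus a)) = 5" if "a = 1/2" using **[of d] by (simp only: that simp_thms if_True)
qed

section \<open>Smoothness of \<open>d_minus\<close> away from \<open>1/2\<close>\<close>

text \<open>Every derivative keeps the form polynomial plus \<open>q n * H powr (s - n)\<close>,
  with a polynomial recursion for \<open>q n\<close>. This gives all derivatives explicitly.\<close>

lemma C_infinity_on_poly_powr:
  fixes P H :: "real poly" and k s :: real
  assumes H: "\<And>x. x \<in> S \<Longrightarrow> 0 < poly H x"
  shows "C_infinity_on S (\<lambda>x. poly P x + k * poly H x powr s)"
proof -
  define q where "q = rec_nat [:k:] (\<lambda>n q. pderiv q * H + smult (s - real n) (q * pderiv H))"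
  have q: "q 0 = [:k:]" "\<And>n. q (Suc n) = pderiv (q n) * H + smult (s - real n) (q n * pderiv H)"
    by (simp_all add: q_def)
  define F where "F = (\<lambda>n x. poly ((pderiv ^^ n) P) x + poly (q n) x * poly H x powr (s - real n))"
  have "(F n has_real_derivative F (Suc n) x) (at x within S)" if x: "x \<in> S" for n x
  proof -
    \<comment> \<open>Absorbing one factor \<open>H\<close> brings both terms of the product rule to
      the exponent \<open>s - n - 1\<close>.\<close>
    have "poly H x * poly H x powr (s - real n - 1) = poly H x powr (s - real n)"
      using powr_add[of "poly H x" 1 "s - real n - 1"] H[OF x] by simp
    hence "F (Suc n) x = poly (pderiv ((pderiv ^^ n) P)) x +
        (poly (pderiv (q n)) x * poly H x powr (s - real n) +
         (s - real n) * poly H x powr (s - real n - 1) * poly (pderiv H) x * poly (q n) x)"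
      by (simp add: F_def q algebra_simps)
    moreover
    have "((\<lambda>x. poly H x powr (s - real n)) has_real_derivative
        (s - real n) * poly H x powr (s - real n - 1) * poly (pderiv H) x) (at x)"
      using DERIV_fun_powr[OF poly_DERIV H[OF x], of "s - real n"]
      by (simp add: mult.commute mult.left_commute)
    hence "(F n has_real_derivative
        poly (pderiv ((pderiv ^^ n) P)) x + (poly (pderiv (q n)) x * poly H x powr (s - real n) +
         (s - real n) * poly H x powr (s - real n - 1) * poly (pderiv H) x * poly (q n) x)) (at x)"
      unfolding F_def by (rule DERIV_add[OF poly_DERIV DERIV_mult[OF poly_DERIV]])
    ultimately show ?thesis by (metis has_field_derivative_at_within)
  qed
  moreover have "F 0 x = poly P x + k * poly H x powr s" for x by (simp add: F_def q)
  ultimately show ?thesis unfolding C_infinity_on_def by blast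
qed

lemma C_infinity_on_d_minus:
  assumes "S \<subseteq> {0..1} - {1/2}"
  shows "C_infinity_on S d_minus"
proof -
  define X :: "real poly" where "X = [:1, -2:]"
  define P where "P = smult (1/72) ([:3:] + X^2)"
  \<comment> \<open>the square makes the base of the power positive on both sides of \<open>1/2\<close>\<close>
  define H where "H = (X * ([:9:] - X^2))^2"
  have X: "poly X a = 1 - 2 * a" for a by (simp add: X_def)
  have H: "poly H a = ((1 - 2 * a) * (9 - (1 - 2 * a)^2))^2" for a by (simp add: H_def X)
  have "d_minus = (\<lambda>a. poly P a + (- 1/72) * poly H a powr (1/3))"
  proof
    fix a
    have "(curt (1 - 2 * a))^2 = poly H a powr (1/3)"
      using root_powr_inverse[of 3 "poly H a"] by (simp add: curt_def real_root_power H)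
    thus "d_minus a = poly P a + (- 1/72) * poly H a powr (1/3)"
      by (simp add: d_minus_def P_def X field_simps)
  qed
  moreover have "0 < poly H a" if "a \<in> S" for a
  proof -
    have "a \<in> {0..1} - {1/2}" using that assms by blast
    hence "a \<noteq> 1/2" "(1 - 2 * a)^2 \<le> 1" by (auto simp: abs_square_le_1)
    thus ?thesis by (simp add: H)
  qed
  ultimately show ?thesis using C_infinity_on_poly_powr[of S H P "- 1/72" "1/3"] by simp
qed

section \<open>Expansions of \<open>d_minus\<close> at 0 and of its inverse at
  \<open>1/24\<close>\<close>

lemma d_minus_expansion:
  "(\<lambda>a. d_minus a - (1/8 * a^2 + 1/32 * a^4)) \<in> O[at_right 0](\<lambda>a. a^5)"
  unfolding d_minus_def curt_def by real_asymp

text \<open>With \<open>r = curt x\<close>, \<open>9 x = r^3 + x^3\<close> and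
  \<open>k = r^2 - x^2\<close>, so \<open>k sqrt k\<close> lies between \<open>r^3 - 2 r x^2\<close>
  and \<open>r^3\<close>. The error is at most \<open>5 x^2\<close>, and \<open>3 x \<le> k\<close>
  turns this into a bound by \<open>k^2\<close>.\<close>

lemma d_minus_inverse_estimate:
  assumes x: "0 \<le> x" "x \<le> 1" and k: "k = (curt x)^2 - x^2"
  shows "\<bar>9 * x - k * sqrt k\<bar> \<le> 5/9 * k^2"
proof (cases "x = 0")
  case True
  thus ?thesis by (simp add: k)
next
  case False
  let ?r = "curt x"
  have r: "2 * x \<le> ?r" "?r \<le> 2" "0 < ?r" using curt_bounds[OF x] x False by auto
  have x2: "x * x \<le> x * 1" using x by (intro mult_left_mono) auto
  have "2 * x * (2 * x) \<le> ?r * ?r" using r x by (intro mult_mono) auto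
  moreover have "0 \<le> x * x" by simp
  ultimately have k0: "0 \<le> k" unfolding k power2_eq_square by linarith
  have kr: "sqrt k \<le> ?r" using r by (intro real_le_lsqrt) (auto simp: k)
  have "k * sqrt k \<le> ?r^2 * ?r" using kr k0 r by (intro mult_mono) (auto simp: k)
  hence up: "k * sqrt k \<le> ?r^3" by (simp add: power3_eq_cube power2_eq_square)
  have "?r^3 - 2 * ?r * x^2 \<le> k * (k / ?r)"
  proof -
    have "?r * (?r^3 - 2 * ?r * x^2) = k * k - x^2 * x^2" unfolding k by algebra
    also have "\<dots> \<le> k * k" by simp
    finally show ?thesis using r by (simp add: field_simps)
  qed
  also have "k / ?r \<le> sqrt k"
  proof -
    have "k = sqrt k * sqrt k" using k0 by simp
    also have "\<dots> \<le> sqrt k * ?r" using kr k0 by (intro mult_left_mono) auto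
    finally show ?thesis using r by (simp add: field_simps)
  qed
  hence "k * (k / ?r) \<le> k * sqrt k" using k0 by (intro mult_left_mono)
  finally have lo: "?r^3 - 2 * ?r * x^2 \<le> k * sqrt k" .
  have "9 * x = ?r^3 + x^3" unfolding curt_cubed by algebra
  moreover have "0 \<le> x^3" "x^3 \<le> x^2" "0 \<le> x^2" using x by (auto intro: power_decreasing)
  moreover have "2 * ?r * x^2 \<le> 4 * x^2" using r by (intro mult_right_mono) auto
  ultimately have "\<bar>9 * x - k * sqrt k\<bar> \<le> 5 * x^2" using up lo by linarith
  also have "3 * x \<le> k"
  proof -
    \<comment> \<open>Here \<open>8 x \<le> r^3 \<le> 2 r^2\<close>, so
      \<open>r^2 \<ge> 4 x\<close>; subtracting \<open>x^2 \<le> x\<close> leaves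
      \<open>k \<ge> 3 x\<close>.\<close>
    have "8 * x \<le> (9 - x * x) * x" using x x2 by (intro mult_right_mono) auto
    also have "\<dots> = ?r * ?r^2" using curt_cubed[of x] by algebra
    also have "\<dots> \<le> 2 * ?r^2" using r by (intro mult_right_mono) auto
    finally show ?thesis using x2 by (simp add: k power2_eq_square)
  qed
  hence "(3 * x)^2 \<le> k^2" using x by (intro power_mono) auto
  hence "5 * x^2 \<le> 5/9 * k^2" by (simp add: power_mult_distrib)
  finally show ?thesis .
qed

lemma d_minus_inverse_expansion:
  "(\<lambda>d. the_inv_into {0..1/2} d_minus d - (1/2 - sqrt (- 1152 * (d - 1/24)^3)))
      \<in> O[at_left (1/24)](\<lambda>d. (d - 1/24)^2)"
proof (rule bigoI)
  have "eventually (\<lambda>d :: real. d \<in> {0<..<1/24}) (at_left (1/24))"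
    by (rule eventually_at_left_real) simp
  \<comment> \<open>The constant is \<open>160 = (5/9) * 72^2 / 18\<close>: the error in
    \<open>9 x\<close> is at most \<open>5/9 k^2\<close>, \<open>k = 72 (1/24 - d)\<close>, and
    \<open>a = (1 - x) / 2\<close> divides it by 18.\<close>
  thus "eventually (\<lambda>d. norm (the_inv_into {0..1/2} d_minus d - (1/2 - sqrt (- 1152 * (d - 1/24)^3)))
     \<le> 160 * norm ((d - 1/24)^2)) (at_left (1/24))"
  proof eventually_elim
    case (elim d)
    define a where "a = the_inv_into {0..1/2} d_minus d"
    have d: "d \<in> d_minus ` {0..1/2}" using elim bij_betw_imp_surj_on[OF d_minus_bij] by auto
    have da: "d_minus a = d" unfolding a_def
      by (rule f_the_inv_into_f[OF bij_betw_imp_inj_on[OF d_minus_bij] d])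
    have a: "a \<in> {0..1/2}" unfolding a_def
      by (rule the_inv_into_into[OF bij_betw_imp_inj_on[OF d_minus_bij] d order_refl])
    define x where "x = 1 - 2 * a"
    \<comment> \<open>Solving \<open>d = d_minus a\<close> for \<open>curt^2 - x^2\<close> gives
      \<open>3 - 72 d\<close>, a quantity that depends on \<open>d\<close> alone.\<close>
    define k where "k = 72 * (1/24 - d)"
    have k: "k = (curt x)^2 - x^2" unfolding k_def da[symmetric] d_minus_def x_def by argo
    have k0: "0 \<le> k" using elim by (simp add: k_def)
    have "(k * sqrt k / 18)^2 = k^3 / 324"
      using k0 by (simp add: power_mult_distrib power_divide power3_eq_cube power2_eq_square)
    also have "\<dots> = - 1152 * (d - 1/24)^3" unfolding k_def by algebra
    finally have sq: "sqrt (- 1152 * (d - 1/24)^3) = k * sqrt k / 18"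
      using k0 by (intro real_sqrt_unique) auto
    have "a - (1/2 - k * sqrt k / 18) = - (9 * x - k * sqrt k) / 18" by (simp add: x_def field_simps)
    hence "\<bar>a - (1/2 - k * sqrt k / 18)\<bar> = \<bar>9 * x - k * sqrt k\<bar> / 18"
      by (simp only: abs_divide abs_minus_cancel abs_numeral)
    also have "\<dots> \<le> (5/9 * k^2) / 18"
      using d_minus_inverse_estimate[OF _ _ k] a by (simp add: x_def)
    also have "\<dots> = 160 * (d - 1/24)^2" unfolding k_def by algebra
    finally show ?case unfolding sq a_def[symmetric] by simp
  qed
qed

theorem proposition3p1:
  shows "\<exists>dm dp :: real \<Rightarrow> real.
    continuous_on {0..1} dm \<and> dm ` {0..1} \<subseteq> {0..} \<and>
    continuous_on {0..1} dp \<and> dp ` {0..1} \<subseteq> {0..} \<and>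
    \<comment> \<open>(i)\<close>
    (\<forall>a. 0 < a \<and> a < 1 \<longrightarrow>
       dp a = deriv (\<lambda>u. g u a) a / 4 \<and>
       dm a = dm (1 - a) \<and> dp a = dp (1 - a) \<and> dm a < dp a) \<and>
    dm 0 = 0 \<and> dp 0 = 0 \<and> dm 1 = 0 \<and> dp 1 = 0 \<and> dm (1/2) = 1/24 \<and>
    \<comment> \<open>(ii)\<close>
    C_infinity_on {0..<1/2} dm \<and> C_infinity_on {1/2<..1} dm \<and>
    strict_mono_on {0..1/2} dm \<and> strict_antimono_on {1/2..1} dm \<and>
    \<comment> \<open>(iii)\<close>
    (\<forall>a. 0 < a \<and> a < 1 \<longrightarrow>
       (\<forall>d. 0 \<le> d \<and> d < dm a \<longrightarrow> card (G_roots a d) = 9) \<and>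
       (\<forall>d. dm a < d \<and> d < dp a \<longrightarrow> card (G_roots a d) = 5) \<and>
       (\<forall>d. dp a \<le> d \<longrightarrow> card (G_roots a d) = 3)) \<and>
    \<comment> \<open>(iv)\<close>
    (\<forall>a. 0 < a \<and> a < 1 \<longrightarrow>
       (a \<noteq> 1/2 \<longrightarrow> card (G_roots a (dm a)) = 7) \<and>
       (a = 1/2 \<longrightarrow> card (G_roots a (dm a)) = 5)) \<and>
    \<comment> \<open>(v)\<close>
    (\<lambda>a. dm a - (1/8 * a^2 + 1/32 * a^4)) \<in> O[at_right 0](\<lambda>a. a^5) \<and>
    bij_betw dm {0..1/2} {0..1/24} \<and>
    (\<lambda>d. the_inv_into {0..1/2} dm d - (1/2 - sqrt (- 1152 * (d - 1/24)^3)))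
      \<in> O[at_left (1/24)](\<lambda>d. (d - 1/24)^2)"
proof (rule exI[of _ d_minus], rule exI[of _ d_plus], intro conjI)
  have *: "d_plus a = deriv (\<lambda>u. g u a) a / 4" for a
  proof -
    have "((\<lambda>u. g u a) has_real_derivative a * (1 - a)) (at a)"
      unfolding g_def by (auto intro!: derivative_eq_intros)
    thus ?thesis by (simp add: DERIV_imp_deriv d_plus_def)
  qed
  show "\<forall>a. 0 < a \<and> a < 1 \<longrightarrow>
       d_plus a = deriv (\<lambda>u. g u a) a / 4 \<and>
       d_minus a = d_minus (1 - a) \<and> d_plus a = d_plus (1 - a) \<and> d_minus a < d_plus a"
    by (intro allI impI conjI; elim conjE; rule * d_minus_reflect[symmetric] d_plus_reflect d_minus_less_d_plus; assumption)
  show "continuous_on {0..1} d_plus" unfolding d_plus_def by (intro continuous_intros) auto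
  show "C_infinity_on {0..<1/2} d_minus" "C_infinity_on {1/2<..1} d_minus"
    by (auto intro!: C_infinity_on_d_minus)
  show "d_minus ` {0..1} \<subseteq> {0..}" "d_plus ` {0..1} \<subseteq> {0..}"
    using d_minus_nonneg by (auto simp: d_plus_def)
  show "d_plus 0 = 0" "d_plus 1 = 0" by (simp_all add: d_plus_def)
  show "\<forall>a. 0 < a \<and> a < 1 \<longrightarrow>
       (\<forall>d. 0 \<le> d \<and> d < d_minus a \<longrightarrow> card (G_roots a d) = 9) \<and>
       (\<forall>d. d_minus a < d \<and> d < d_plus a \<longrightarrow> card (G_roots a d) = 5) \<and>
       (\<forall>d. d_plus a \<le> d \<longrightarrow> card (G_roots a d) = 3)"
    by (intro allI impI conjI; elim conjE; rule card_G_roots_cases; assumption)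
  show "\<forall>a. 0 < a \<and> a < 1 \<longrightarrow>
       (a \<noteq> 1/2 \<longrightarrow> card (G_roots a (d_minus a)) = 7) \<and>
       (a = 1/2 \<longrightarrow> card (G_roots a (d_minus a)) = 5)"
    by (intro allI impI conjI; elim conjE; rule card_G_roots_cases; assumption)
qed (fact continuous_on_d_minus d_minus_values d_minus_strict_mono d_minus_strict_antimono
       d_minus_bij d_minus_expansion d_minus_inverse_expansion)+

end
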